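(* Let $\eta_1,\eta_2,\eta_3\ge0$, $\mathfrak L>0$, and let $f\in\mathcal G(\eta_1,\mathfrak L)\cap\mathcal W^{2,p_0}_{\mathrm{loc}}(\mathbb R^d)$ for some $p_0\ge d$, with $\nabla f\in L^{2d}_{\mathrm{loc}}(\mathbb R^d)$, be such that $\|\nabla f(x)\|\lesssim1+\|x\|^{\eta_2}$ and, for all $i,j=1,\dots,d$, $|\partial_{x_i,x_j}f(x)|\lesssim1+\|x\|^{\eta_3}$. Define $\alpha=(q'+\eta_2)\vee\eta_3$; if $q>-1$ let $\tilde\gamma>1+q$ and $r>1$ be such that $\tilde\gamma-(1+q)>r\big(\alpha\vee\frac{1+q}{r-1}\big)$, and if $q=-1$ set $\tilde\gamma=\alpha$. Put $$\varrho=\frac{\max\{(\tilde\gamma+2\alpha+1-q_+)/2,\ \eta_2+1-q_+\}}{1-q_+},\qquad\tilde\varsigma=\frac12+\frac{\eta_1+q'+q+1}{1-q_+}.$$ For $\varepsilon>0$, $\delta\in(0,\mathrm e^{-2})$, suppose that $\Delta\in(0,1]$ satisfies $\Delta<\varepsilon/(3\mathrm e\mathfrak D)$ and $$n\ge\Psi(\Delta,\varepsilon,\delta):=\frac1\Delta\left(\frac{3\mathrm e\mathfrak D\max\{\Delta(\log(1/\delta))^{\varrho},(\log(1/\delta))^{\tilde\varsigma}\}}{\varepsilon}\right)^2.$$ Then $$\mathbb P^\mu\Big(\Big|\frac1n\sum_{k=1}^nf(X_{k\Delta})-\mu(f)\Big|\le\varepsilon\Big)\ge1-\delta.$$ Moreover,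 let $\mathbb H_{m,n,\Delta}(f)=\frac1n\sum_{k=m+1}^{n+m}f(X_{k\Delta})$. Then, given any initial distribution $\nu$ with $V_{q_+}\in L^1(\nu)$, for any $n\ge\Psi(\Delta,\varepsilon,\delta/2)$ and burn-in length $m\ge1\vee\Delta^{-1}(\log(2C/\delta))^{(1+q_+)/(1-q_+)}/\iota''$, $$\mathbb P^\nu\big(|\mathbb H_{m,n,\Delta}(f)-\mu(f)|\le\varepsilon\big)\ge1-\delta.$$
   Context: Setting. $\|\cdot\|$ is the Euclidean norm. $X=(X_t)_{t\ge0}$ with the family $(\mathbb P^x)_{x\in\mathbb R^d}$ is the Markovian weak solution, with continuous paths, of $dX_t=b(X_t)\,dt+\sigma(X_t)\,dW_t$ on $\mathbb R^d$, with $X_0=x$ under $\mathbb P^x$; $\mathbb P^\nu=\int\mathbb P^x\,\nu(dx)$. Here $b:\mathbb R^d\to\mathbb R^d$ is locally Lipschitz with $\|b(x)\|\le \mathrm{const}\,(1+\|x\|^{q'})$ for some $q'\ge 0$; $\sigma:\mathbb R^d\to\mathbb R^{d\times d}$ is uniformly continuous, bounded and locally Lipschitz; $a:=\sigma\sigma^\top$ is uniformly elliptic, i.e. for some $\lambda>0$, $\langle a(x)\xi,\xi\rangle\ge\lambda\|\xi\|^2$ for all $x,\xi$. Drift condition: there are $q\in[-1,1)$, $M_0\ge0$, $\mathfrak r>0$ with $\langle b(x),x/\|x\|\rangle\le-\mathfrak r\|x\|^{-q}$ whenever $\|x\|\ge M_0$. $q_+=\max\{q,0\}$. Then $X$ has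 a unique invariant distribution $\mu$; $\mu(f)=\int f\,d\mu$. $\mathcal G(\eta,\mathfrak L)=\{f:\mathbb R^d\to\mathbb R\ \text{Borel}:\ |f(x)|\le\mathfrak L(1+\|x\|^\eta)\ \forall x\}$. Derivatives are weak derivatives; $g\lesssim h$ means $g\le\mathrm{const}\cdot h$. Constants. With $\mathbb G_{n,\Delta}(g)=\frac1{\sqrt{n\Delta}}\sum_{k=1}^ng(X_{k\Delta})\Delta$, $\mathfrak D$ denotes a constant independent of $n,p,\Delta$ (such a constant exists) with $$\|\mathbb G_{n,\Delta}(f-\mu(f))\|_{L^p(\mathbb P^\mu)}\le\mathfrak D\big(\sqrt n\Delta^{3/2}+\Delta p^{\varrho}+p^{\tilde\varsigma}\big)=:\Phi(n,\Delta,p)\quad\text{for all }p\ge2,\ n\in\mathbb N,\ \Delta\in(0,1],$$ so that $\mathbb P^\mu(|\mathbb G_{n,\Delta}(f-\mu(f))|>\mathrm e\Phi(n,\Delta,u))\le\mathrm e^{-u}$ for $u\ge2$. $\lambda_+$ is the smallest constant with $\langle a(x)x/\|x\|,x/\|x\|\rangle\le\lambda_+$ for all $x\ne0$; $\iota>0$ is fixed with $\mathfrak r>\iota\lambda_+(1-q_+)/2$; $V_{q_+}(x)=\exp(\iota\|x\|^{1-q_+})$; $\iota'=\iota^{(1+q_+)/(1-q_+)}(1+q_+)(\mathfrak r-\lambda_+\iota(1-q_+)/2)$; $\iota''\in(0,\iota')$ is fixed. $C(q_+)$ is a constant (known to exist) such that, with $\|\nu\|_{TV}=\sup_{\|g\|_\infty\le1}|\nu(g)|$,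 $\|\mathbb P^x(X_t\in\cdot)-\mu\|_{TV}\le C(q_+)V_{q_+}(x)(1+t)^{\frac{2q_+}{1+q_+}}\mathrm e^{-(\iota't)^{(1-q_+)/(1+q_+)}}$ for all $x\in\mathbb R^d$, $t\ge0$. Finally $C=C(q_+)\,c(\iota'')\,\|V_{q_+}\|_{L^1(\nu)}$, where $c(\iota'')$ is a constant such that $(1+t)^{\frac{2q_+}{1+q_+}}\mathrm e^{-(\iota't)^{(1-q_+)/(1+q_+)}}\le c(\iota'')\mathrm e^{-(\iota''t)^{(1-q_+)/(1+q_+)}}$ for all $t\ge1$.
   Formalization: In the burn-in claim it is additionally assumed that c(ι'') ≥ 1 or mΔ ≥ 1; without this the claim can fail, because c(ι'') is only constrained for t ≥ 1 while m ≥ 1 allows mΔ < 1. *)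

theory Defs
  imports "HOL-Probability.Probability"
begin

section \<open>Brownian motion, stochastic integral and Markovian weak solutions\<close>

text \<open>A filtration is indexed by all reals; only the times \<open>t \<ge> 0\<close> matter.
  Paths of \<open>W\<close> are continuous almost surely, so that no completion of the filtration is required.\<close>

definition brownian_motion ::
  "'w measure \<Rightarrow> (real \<Rightarrow> 'w measure) \<Rightarrow> (real \<Rightarrow> 'w \<Rightarrow> real^'d) \<Rightarrow> bool" where
  "brownian_motion P F W \<longleftrightarrow>
     (\<forall>t\<ge>0. W t \<in> F t \<rightarrow>\<^sub>M borel) \<and>
     (AE \<omega> in P. W 0 \<omega> = 0) \<and>
     (AE \<omega> in P. continuous_on {0..} (\<lambda>t. W t \<omega>)) \<and>
     (\<forall>s t. 0 \<le> s \<and> s < t \<longrightarrow>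
        prob_space.indep_set P (sets (F s))
          (sets (vimage_algebra (space P) (\<lambda>\<omega>. W t \<omega> - W s \<omega>) borel)) \<and>
        distributed P lborel (\<lambda>\<omega>. W t \<omega> - W s \<omega>)
          (\<lambda>x. ennreal (\<Prod>i\<in>UNIV. normal_density 0 (sqrt (t - s)) (x $ i))))"

text \<open>The simple process \<open>\<Sum>l<k. \<xi>\<^sub>l 1\<^bsub>(\<tau>\<^sub>l, \<tau>\<^bsub>l+1\<^esub>]\<^esub>\<close>, with bounded
  \<open>F (\<tau> l)\<close>-measurable matrix coefficients \<open>\<xi> l\<close>.\<close>

definition simple_process ::
  "(real \<Rightarrow> 'w measure) \<Rightarrow> nat \<Rightarrow> (nat \<Rightarrow> real) \<Rightarrow> (nat \<Rightarrow> 'w \<Rightarrow> real^'d^'d) \<Rightarrow> bool" where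
  "simple_process F k \<tau> \<xi> \<longleftrightarrow>
     0 \<le> \<tau> 0 \<and> (\<forall>l<k. \<tau> l \<le> \<tau> (Suc l)) \<and>
     (\<forall>l<k. \<xi> l \<in> F (\<tau> l) \<rightarrow>\<^sub>M borel \<and> bounded (\<xi> l ` space (F (\<tau> l))))"

definition simple_value ::
  "nat \<Rightarrow> (nat \<Rightarrow> real) \<Rightarrow> (nat \<Rightarrow> 'w \<Rightarrow> real^'d^'d) \<Rightarrow> real \<Rightarrow> 'w \<Rightarrow> real^'d^'d" where
  "simple_value k \<tau> \<xi> s \<omega> = (\<Sum>l<k. indicator {\<tau> l<..\<tau> (Suc l)} s *\<^sub>R \<xi> l \<omega>)"

definition simple_integral ::
  "(real \<Rightarrow> 'w \<Rightarrow> real^'d) \<Rightarrow> real \<Rightarrow> nat \<Rightarrow> (nat \<Rightarrow> real) \<Rightarrow> (nat \<Rightarrow> 'w \<Rightarrow> real^'d^'d) \<Rightarrow> 'w \<Rightarrow> real^'d" where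
  "simple_integral W T k \<tau> \<xi> \<omega> = (\<Sum>l<k. \<xi> l \<omega> *v (W (min (\<tau> (Suc l)) T) \<omega> - W (min (\<tau> l) T) \<omega>))"

text \<open>\<open>I\<close> is (a version of) the stochastic integral of \<open>H\<close> with respect to \<open>W\<close> over \<open>[0, T]\<close>,
  as the \<open>L\<^sup>2(P)\<close>-limit of integrals of simple processes approximating \<open>H\<close> in
  \<open>L\<^sup>2(P \<otimes> ds)\<close>. The square-integrable theory suffices here, since the diffusion
  coefficient is bounded.\<close>

definition has_ito_integral ::
  "'w measure \<Rightarrow> (real \<Rightarrow> 'w measure) \<Rightarrow> (real \<Rightarrow> 'w \<Rightarrow> real^'d) \<Rightarrow> real
    \<Rightarrow> (real \<Rightarrow> 'w \<Rightarrow> real^'d^'d) \<Rightarrow> ('w \<Rightarrow> real^'d) \<Rightarrow> bool" where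
  "has_ito_integral P F W T H I \<longleftrightarrow> I \<in> borel_measurable P \<and>
     (\<exists>k \<tau> \<xi>. (\<forall>n. simple_process F (k n) (\<tau> n) (\<xi> n)) \<and>
        (\<lambda>n. \<integral>\<^sup>+\<omega>. (\<integral>\<^sup>+s\<in>{0..T}. ennreal ((norm (simple_value (k n) (\<tau> n) (\<xi> n) s \<omega> - H s \<omega>))\<^sup>2) \<partial>lborel) \<partial>P)
          \<longlonglongrightarrow> 0 \<and>
        (\<lambda>n. \<integral>\<^sup>+\<omega>. ennreal ((norm (simple_integral W T (k n) (\<tau> n) (\<xi> n) \<omega> - I \<omega>))\<^sup>2) \<partial>P)
          \<longlonglongrightarrow> 0)"

definition weak_solution ::
  "'w measure \<Rightarrow> (real \<Rightarrow> 'w measure) \<Rightarrow> (real \<Rightarrow> 'w \<Rightarrow> real^'d)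
    \<Rightarrow> (real^'d \<Rightarrow> real^'d) \<Rightarrow> (real^'d \<Rightarrow> real^'d^'d) \<Rightarrow> real^'d \<Rightarrow> bool" where
  "weak_solution P F X b \<sigma> x \<longleftrightarrow>
     (AE \<omega> in P. X 0 \<omega> = x) \<and>
     (\<exists>W. brownian_motion P F W \<and>
        (\<forall>t\<ge>0. \<exists>I. has_ito_integral P F W t (\<lambda>s \<omega>. \<sigma> (X s \<omega>)) I \<and>
           (AE \<omega> in P. X t \<omega> = x + (LINT s:{0..t}|lborel. b (X s \<omega>)) + I \<omega>)))"

text \<open>\<open>M\<close> only provides the measurable space carrying the process; the family \<open>P\<close> is a kernel of
  probability measures on it, so that \<open>\<nu> \<bind> P\<close> is the mixture \<open>\<integral> P x \<nu>(dx)\<close>.\<close>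

definition markovian_weak_solution ::
  "'w measure \<Rightarrow> (real \<Rightarrow> 'w measure) \<Rightarrow> (real^'d \<Rightarrow> 'w measure) \<Rightarrow> (real \<Rightarrow> 'w \<Rightarrow> real^'d)
    \<Rightarrow> (real^'d \<Rightarrow> real^'d) \<Rightarrow> (real^'d \<Rightarrow> real^'d^'d) \<Rightarrow> bool" where
  "markovian_weak_solution M F P X b \<sigma> \<longleftrightarrow>
     filtration (space M) F \<and> (\<forall>t. sets (F t) \<subseteq> sets M) \<and>
     P \<in> borel \<rightarrow>\<^sub>M prob_algebra M \<and>
     (\<forall>t\<ge>0. X t \<in> F t \<rightarrow>\<^sub>M borel) \<and>
     (\<forall>\<omega>\<in>space M. continuous_on {0..} (\<lambda>t. X t \<omega>)) \<and>
     (\<forall>x. weak_solution (P x) F X b \<sigma> x) \<and>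
     (\<forall>x s t A. 0 \<le> s \<and> 0 \<le> t \<and> A \<in> sets borel \<longrightarrow>
        (AE \<omega> in P x. real_cond_exp (P x) (F t) (indicator (X (t + s) -` A \<inter> space M)) \<omega>
           = measure (P (X t \<omega>)) (X s -` A \<inter> space M)))"

definition invariant_distribution ::
  "(real^'d \<Rightarrow> 'w measure) \<Rightarrow> (real \<Rightarrow> 'w \<Rightarrow> real^'d) \<Rightarrow> (real^'d) measure \<Rightarrow> bool" where
  "invariant_distribution P X \<mu> \<longleftrightarrow>
     prob_space \<mu> \<and> sets \<mu> = sets borel \<and> (\<forall>t\<ge>0. distr (\<mu> \<bind> P) borel (X t) = \<mu>)"

text \<open>Total variation norm of \<open>\<nu> - \<mu>\<close>, normalised to take values in \<open>[0, 2]\<close>.\<close>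

definition tv_norm_diff :: "(real^'d) measure \<Rightarrow> (real^'d) measure \<Rightarrow> real" where
  "tv_norm_diff \<nu> \<mu> = Sup {\<bar>(\<integral>x. g x \<partial>\<nu>) - (\<integral>x. g x \<partial>\<mu>)\<bar> | g. g \<in> borel_measurable borel \<and> (\<forall>x. \<bar>g x\<bar> \<le> 1)}"

text \<open>Extended-valued, so that a finite bound entails \<open>p\<close>-integrability.\<close>

definition Lp_norm :: "real \<Rightarrow> 'w measure \<Rightarrow> ('w \<Rightarrow> real) \<Rightarrow> ennreal" where
  "Lp_norm p M g = (let I = \<integral>\<^sup>+\<omega>. ennreal (\<bar>g \<omega>\<bar> powr p) \<partial>M in
     if I = \<infinity> then \<infinity> else ennreal (enn2real I powr (1 / p)))"


section \<open>Assumptions on the coefficients\<close>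

text \<open>\<open>\<parallel>x\<parallel>\<^sup>\<eta>\<close> with the convention \<open>0\<^sup>0 = 1\<close>, whereas \<open>0 powr 0 = 0\<close>.\<close>

definition norm_pow :: "real^'d \<Rightarrow> real \<Rightarrow> real" where
  "norm_pow x \<eta> = (if \<eta> = 0 then 1 else norm x powr \<eta>)"

definition diffusion_matrix :: "(real^'d \<Rightarrow> real^'d^'d) \<Rightarrow> real^'d \<Rightarrow> real^'d^'d" where
  "diffusion_matrix \<sigma> x = \<sigma> x ** transpose (\<sigma> x)"

definition coefficient_assumptions ::
  "(real^'d \<Rightarrow> real^'d) \<Rightarrow> (real^'d \<Rightarrow> real^'d^'d) \<Rightarrow> real \<Rightarrow> bool" where
  "coefficient_assumptions b \<sigma> q' \<longleftrightarrow>
     local_lipschitz (UNIV :: real set) UNIV (\<lambda>_. b) \<and>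
     (\<exists>K. \<forall>x. norm (b x) \<le> K * (1 + norm_pow x q')) \<and>
     uniformly_continuous_on UNIV \<sigma> \<and> bounded (range \<sigma>) \<and>
     local_lipschitz (UNIV :: real set) UNIV (\<lambda>_. \<sigma>) \<and>
     (\<exists>l>0. \<forall>x \<xi>. (diffusion_matrix \<sigma> x *v \<xi>) \<bullet> \<xi> \<ge> l * (norm \<xi>)\<^sup>2)"

definition drift_condition :: "(real^'d \<Rightarrow> real^'d) \<Rightarrow> real \<Rightarrow> real \<Rightarrow> real \<Rightarrow> bool" where
  "drift_condition b q M0 rr \<longleftrightarrow>
     (\<forall>x. x \<noteq> 0 \<and> norm x \<ge> M0 \<longrightarrow> b x \<bullet> (x /\<^sub>R norm x) \<le> - rr * norm x powr (- q))"

definition lambda_plus :: "(real^'d \<Rightarrow> real^'d^'d) \<Rightarrow> real" where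
  "lambda_plus \<sigma> = (LEAST l. \<forall>x. x \<noteq> 0 \<longrightarrow>
     (diffusion_matrix \<sigma> x *v (x /\<^sub>R norm x)) \<bullet> (x /\<^sub>R norm x) \<le> l)"

definition lyapunov :: "real \<Rightarrow> real \<Rightarrow> real^'d \<Rightarrow> real" where
  "lyapunov \<iota> qp x = exp (\<iota> * norm x powr (1 - qp))"

definition growth_class :: "real \<Rightarrow> real \<Rightarrow> (real^'d \<Rightarrow> real) set" where
  "growth_class \<eta> L = {f. f \<in> borel_measurable borel \<and> (\<forall>x. \<bar>f x\<bar> \<le> L * (1 + norm_pow x \<eta>))}"


section \<open>Weak derivatives and local Sobolev spaces\<close>

definition partial_deriv :: "'d \<Rightarrow> (real^'d \<Rightarrow> real) \<Rightarrow> real^'d \<Rightarrow> real" where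
  "partial_deriv i \<phi> x = frechet_derivative \<phi> (at x) (axis i 1)"

primrec Ck :: "nat \<Rightarrow> (real^'d \<Rightarrow> real) \<Rightarrow> bool" where
  "Ck 0 \<phi> = continuous_on UNIV \<phi>"
| "Ck (Suc k) \<phi> = ((\<forall>x. \<phi> differentiable (at x)) \<and> (\<forall>i. Ck k (partial_deriv i \<phi>)))"

definition test_functions :: "(real^'d \<Rightarrow> real) set" where
  "test_functions = {\<phi>. (\<forall>k. Ck k \<phi>) \<and> compact (closure {x. \<phi> x \<noteq> 0})}"

definition Lp_loc :: "real \<Rightarrow> (real^'d \<Rightarrow> real) set" where
  "Lp_loc p = {u. u \<in> borel_measurable borel \<and>
     (\<forall>K. compact K \<longrightarrow> set_integrable lborel K (\<lambda>x. \<bar>u x\<bar> powr p))}"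

text \<open>\<open>v\<close> is (a version of) the weak partial derivative of \<open>u\<close> in direction \<open>i\<close>.\<close>

definition weak_partial :: "'d \<Rightarrow> (real^'d \<Rightarrow> real) \<Rightarrow> (real^'d \<Rightarrow> real) \<Rightarrow> bool" where
  "weak_partial i u v \<longleftrightarrow> u \<in> Lp_loc 1 \<and> v \<in> Lp_loc 1 \<and>
     (\<forall>\<phi>\<in>test_functions. (LINT x|lborel. u x * partial_deriv i \<phi> x) = - (LINT x|lborel. v x * \<phi> x))"

definition W2_loc :: "real \<Rightarrow> (real^'d \<Rightarrow> real) set" where
  "W2_loc p = {u. u \<in> Lp_loc p \<and>
     (\<forall>i. \<exists>v. weak_partial i u v \<and> v \<in> Lp_loc p \<and>
        (\<forall>j. \<exists>w. weak_partial j v w \<and> w \<in> Lp_loc p))}"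


section \<open>Sampling estimators\<close>

definition scaled_sum ::
  "(real \<Rightarrow> 'w \<Rightarrow> real^'d) \<Rightarrow> nat \<Rightarrow> real \<Rightarrow> (real^'d \<Rightarrow> real) \<Rightarrow> 'w \<Rightarrow> real" where
  "scaled_sum X n \<Delta> g \<omega> = 1 / sqrt (real n * \<Delta>) * (\<Sum>k=1..n. g (X (real k * \<Delta>) \<omega>) * \<Delta>)"

definition burn_in_mean ::
  "(real \<Rightarrow> 'w \<Rightarrow> real^'d) \<Rightarrow> nat \<Rightarrow> nat \<Rightarrow> real \<Rightarrow> (real^'d \<Rightarrow> real) \<Rightarrow> 'w \<Rightarrow> real" where
  "burn_in_mean X m n \<Delta> f \<omega> = 1 / real n * (\<Sum>k=m+1..n+m. f (X (real k * \<Delta>) \<omega>))"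

definition sample_size :: "real \<Rightarrow> real \<Rightarrow> real \<Rightarrow> real \<Rightarrow> real \<Rightarrow> real \<Rightarrow> real" where
  "sample_size D \<rho> \<zeta> \<Delta> \<epsilon> \<delta> =
     1 / \<Delta> * (3 * exp 1 * D * max (\<Delta> * ln (1 / \<delta>) powr \<rho>) (ln (1 / \<delta>) powr \<zeta>) / \<epsilon>)\<^sup>2"

end

theory Submission
  imports Defs
begin

text \<open>
  Under \<open>P\<^sup>\<mu>\<close> the bound is Markov's inequality at the exponent \<open>p = ln (1/\<delta>)\<close>: an
  \<open>L\<^sup>p\<close> norm of at most \<open>\<Phi>\<close> makes \<open>e \<Phi>\<close> an upper quantile at level \<open>e\<^sup>-\<^sup>p = \<delta>\<close>. Since
  the error of the sample mean is the scaled sum divided by \<open>sqrt (n \<Delta>)\<close>, the three summands of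
  \<open>\<Phi>\<close> contribute at most \<open>\<epsilon>/3\<close> each: the first because \<open>\<Delta> < \<epsilon>/(3 e D)\<close>, the other two
  because of the lower bound on \<open>n\<close> (\<open>sample_mean_concentration\<close>).

  For a general initial law, the Markov property at the end \<open>t = m \<Delta>\<close> of the burn-in period
  says that the probability of a bad event after the burn-in is the average, over the law of
  \<open>X t\<close>, of the function \<open>h\<close> that assigns to \<open>y\<close> the probability of the same bad event
  without burn-in under \<open>P y\<close>. Under \<open>\<mu>\<close> the average of \<open>h\<close> is at most \<open>\<delta>/2\<close> by the stationary
  case, and replacing the law of \<open>X t\<close> by \<open>\<mu>\<close> costs at most half of the total variation
  norm of their difference (\<open>burn_in_transfer\<close>). The choice of \<open>m\<close> makes this cost, integrated over
  the initial law, at most \<open>\<delta>/2\<close> (\<open>exp_burn_in_le\<close>). As the Markov property is only assumed for single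
  times, it has first to be extended to sums along the whole sample, which is an induction on the
  number of samples (\<open>nn_integral_sampled_sum\<close>).

  If \<open>m \<Delta> < 1\<close>, the comparison of the two exponential rates through \<open>c\<close> is not available. Then
  \<open>c \<ge> 1\<close>, and the polynomial factor in the convergence bound is at most \<open>2\<close>, which is exactly
  what the factor \<open>1/2\<close> in front of the total variation norm absorbs (\<open>half_rate_le\<close>).
\<close>

section \<open>Concentration of the sample mean from moment bounds\<close>

text \<open>Exceeding the bound on the \<open>L\<^sup>p\<close> norm by the factor \<open>e\<close> costs a factor \<open>e\<^sup>-\<^sup>p\<close> in
  Markov's inequality for \<open>\<bar>g\<bar>\<^sup>p\<close>.\<close>
lemma Lp_norm_tail:
  assumes [measurable]: "g \<in> borel_measurable Q"
    and p: "0 < p" and \<Phi>: "0 < \<Phi>" and bound: "Lp_norm p Q g \<le> ennreal \<Phi>"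
  shows "emeasure Q {\<omega> \<in> space Q. \<bar>g \<omega>\<bar> > exp 1 * \<Phi>} \<le> ennreal (exp (- p))"
proof -
  define I where "I = (\<integral>\<^sup>+\<omega>. ennreal (\<bar>g \<omega>\<bar> powr p) \<partial>Q)"
  have fin: "I \<noteq> \<infinity>"
    using bound by (auto simp: Lp_norm_def I_def Let_def top_unique)
  have "ennreal (enn2real I powr (1 / p)) \<le> ennreal \<Phi>"
    using bound fin by (simp add: Lp_norm_def I_def Let_def)
  then have "enn2real I powr (1 / p) \<le> \<Phi>"
    using \<Phi> by (simp add: ennreal_le_iff)
  then have "(enn2real I powr (1 / p)) powr p \<le> \<Phi> powr p"
    using p by (intro powr_mono2) auto
  then have "enn2real I \<le> \<Phi> powr p"
    using p by (simp add: powr_powr)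
  then have I_le: "I \<le> ennreal (\<Phi> powr p)"
    using fin by (metis ennreal_enn2real_if ennreal_leI infinity_ennreal_def)
  let ?B = "{\<omega> \<in> space Q. \<bar>g \<omega>\<bar> > exp 1 * \<Phi>}"
  have "ennreal ((exp 1 * \<Phi>) powr p) * emeasure Q ?B = (\<integral>\<^sup>+\<omega>. ennreal ((exp 1 * \<Phi>) powr p) * indicator ?B \<omega> \<partial>Q)"
    by (subst nn_integral_cmult_indicator) auto
  also have "\<dots> \<le> I"
    unfolding I_def using p \<Phi>
    by (intro nn_integral_mono) (auto simp: indicator_def intro!: powr_mono2)
  also note I_le
  finally have le: "ennreal ((exp 1 * \<Phi>) powr p) * emeasure Q ?B \<le> ennreal (\<Phi> powr p)" .
  have split: "\<Phi> powr p = (exp 1 * \<Phi>) powr p * exp (- p)"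
    using \<Phi> by (simp add: powr_mult exp_powr_real exp_minus)
  have "ennreal ((exp 1 * \<Phi>) powr p) * emeasure Q ?B
      \<le> ennreal ((exp 1 * \<Phi>) powr p) * ennreal (exp (- p))"
    using le unfolding split by (simp add: ennreal_mult)
  moreover have "0 < (exp 1 * \<Phi>) powr p"
    using \<Phi> by simp
  ultimately show ?thesis
    by (subst (asm) ennreal_mult_le_mult_iff) auto
qed

text \<open>A positive bound on the real number \<open>n\<close> gives \<open>n \<ge> 1\<close>, without which neither the division
  by \<open>n\<close> nor the moment bound makes sense.\<close>
lemma sample_size_pos:
  assumes "0 < D" "0 < \<epsilon>" "0 < \<Delta>" "0 < \<delta>" "\<delta> < 1"
  shows "0 < sample_size D \<rho> \<zeta> \<Delta> \<epsilon> \<delta>"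
proof -
  have "0 < ln (1 / \<delta>)"
    using assms by simp
  then have "0 < max (\<Delta> * ln (1 / \<delta>) powr \<rho>) (ln (1 / \<delta>) powr \<zeta>)"
    by (simp add: less_max_iff_disj)
  then show ?thesis
    unfolding sample_size_def using assms by simp
qed

lemma sample_mean_eq_scaled_sum:
  assumes "1 \<le> n" "0 < \<Delta>"
  shows "1 / real n * (\<Sum>k=1..n. f (X (real k * \<Delta>) \<omega>)) - c
    = scaled_sum X n \<Delta> (\<lambda>x. f x - c) \<omega> / sqrt (real n * \<Delta>)"
proof -
  let ?S = "\<Sum>k=1..n. f (X (real k * \<Delta>) \<omega>)"
  have "(\<Sum>k=1..n. (f (X (real k * \<Delta>) \<omega>) - c) * \<Delta>) = (?S - real n * c) * \<Delta>"
    by (simp add: sum_distrib_right[symmetric] sum_subtractf)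
  moreover have "sqrt (real n * \<Delta>) * sqrt (real n * \<Delta>) = real n * \<Delta>"
    using assms by simp
  ultimately have "scaled_sum X n \<Delta> (\<lambda>x. f x - c) \<omega> / sqrt (real n * \<Delta>)
      = (?S - real n * c) * \<Delta> / (real n * \<Delta>)"
    unfolding scaled_sum_def by simp
  also have "\<dots> = 1 / real n * ?S - c"
    using assms by (simp add: diff_divide_distrib)
  finally show ?thesis
    by (rule sym)
qed

text \<open>The exponent is tied to the confidence level by \<open>p = ln (1/\<delta>)\<close>, so that the tail
  \<open>e\<^sup>-\<^sup>p\<close> of Markov's inequality equals \<open>\<delta>\<close>. What remains is to see that \<open>e \<Phi> \<le> \<epsilon> sqrt (n \<Delta>)\<close>.\<close>
lemma sample_mean_concentration:
  assumes "prob_space Q"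
    and meas: "\<And>t. 0 \<le> t \<Longrightarrow> (\<lambda>\<omega>. f (X t \<omega>)) \<in> borel_measurable Q"
    and D: "0 < D" and \<epsilon>: "0 < \<epsilon>" and \<delta>: "0 < \<delta>" "\<delta> < 1"
    and \<Delta>: "0 < \<Delta>" "\<Delta> < \<epsilon> / (3 * exp 1 * D)"
    and bound: "1 \<le> n \<Longrightarrow> Lp_norm (ln (1 / \<delta>)) Q (scaled_sum X n \<Delta> (\<lambda>x. f x - c))
      \<le> ennreal (D * (sqrt (real n) * \<Delta> powr (3 / 2) + \<Delta> * ln (1 / \<delta>) powr \<rho> + ln (1 / \<delta>) powr \<zeta>))"
    and n: "sample_size D \<rho> \<zeta> \<Delta> \<epsilon> \<delta> \<le> real n"
  shows "measure Q {\<omega> \<in> space Q. \<bar>1 / real n * (\<Sum>k=1..n. f (X (real k * \<Delta>) \<omega>)) - c\<bar> \<le> \<epsilon>} \<ge> 1 - \<delta>"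
proof -
  interpret Q: prob_space Q by fact
  note [measurable] = meas
  define u where "u = ln (1 / \<delta>)"
  define \<Phi> where "\<Phi> = D * (sqrt (real n) * \<Delta> powr (3 / 2) + \<Delta> * u powr \<rho> + u powr \<zeta>)"
  define G where "G = scaled_sum X n \<Delta> (\<lambda>x. f x - c)"
  define N where "N = max (\<Delta> * u powr \<rho>) (u powr \<zeta>)"
  let ?R = "sqrt (real n * \<Delta>)"
  have u: "0 < u"
    unfolding u_def using \<delta> by simp
  have n1: "1 \<le> n"
    using sample_size_pos[of D \<epsilon> \<Delta> \<delta> \<rho> \<zeta>] n assms by (cases n) auto
  have R: "0 < ?R"
    using n1 \<Delta> by simp
  have G_meas [measurable]: "G \<in> borel_measurable Q"
    unfolding G_def scaled_sum_def[abs_def] using \<Delta>(1)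
    by (intro borel_measurable_times borel_measurable_const borel_measurable_sum borel_measurable_diff meas) auto
  have \<Phi>: "0 < \<Phi>"
    unfolding \<Phi>_def using D u n1 \<Delta> by (intro mult_pos_pos add_nonneg_pos) auto
  have "emeasure Q {\<omega> \<in> space Q. \<bar>G \<omega>\<bar> > exp 1 * \<Phi>} \<le> ennreal (exp (- u))"
    using bound[OF n1] by (intro Lp_norm_tail G_meas u \<Phi>) (auto simp: G_def \<Phi>_def u_def)
  also have "exp (- u) = \<delta>"
    unfolding u_def using \<delta> by (simp add: ln_div)
  finally have tail: "measure Q {\<omega> \<in> space Q. \<bar>G \<omega>\<bar> > exp 1 * \<Phi>} \<le> \<delta>"
    using \<delta> by (simp add: Q.emeasure_eq_measure)
  have N_le: "3 * exp 1 * D * N / \<epsilon> \<le> ?R"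
  proof (rule real_le_rsqrt)
    show "(3 * exp 1 * D * N / \<epsilon>)\<^sup>2 \<le> real n * \<Delta>"
      using n \<Delta>(1) unfolding sample_size_def u_def[symmetric] N_def[symmetric]
      by (simp only: times_divide_eq_left mult_1 pos_divide_le_eq)
  qed
  \<comment> \<open>The first summand of \<open>\<Phi>\<close> is \<open>\<Delta>\<close> times the normalisation \<open>sqrt (n \<Delta>)\<close>; the other two
    are each at most \<open>N\<close>, which explains the factor 3 in the sample size.\<close>
  have "\<Delta> powr (3 / 2) = \<Delta> * sqrt \<Delta>"
    using \<Delta>(1) powr_add[of \<Delta> 1 "1/2"] by (simp add: powr_half_sqrt)
  then have "\<Phi> = D * (\<Delta> * ?R + (\<Delta> * u powr \<rho> + u powr \<zeta>))"
    unfolding \<Phi>_def by (simp add: real_sqrt_mult algebra_simps)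
  also have "\<dots> \<le> D * (\<Delta> * ?R + 2 * N)"
    using D by (intro mult_left_mono add_left_mono) (auto simp: N_def)
  finally have "3 * (exp 1 * \<Phi>) \<le> 3 * (exp 1 * (D * (\<Delta> * ?R + 2 * N)))"
    by simp
  also have "\<dots> = (3 * exp 1 * D * \<Delta>) * ?R + 2 * (3 * exp 1 * D * N)"
    by (simp add: algebra_simps)
  also have "\<dots> \<le> \<epsilon> * ?R + 2 * (\<epsilon> * ?R)"
  proof (intro add_mono mult_left_mono mult_right_mono)
    show "3 * exp 1 * D * \<Delta> \<le> \<epsilon>"
      using \<Delta>(2) D by (simp add: field_simps)
    show "3 * exp 1 * D * N \<le> \<epsilon> * ?R"
      using N_le \<epsilon> by (simp add: field_simps)
  qed (use R in auto)
  finally have threshold: "exp 1 * \<Phi> \<le> \<epsilon> * ?R"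
    by simp
  have mean: "1 / real n * (\<Sum>k=1..n. f (X (real k * \<Delta>) \<omega>)) - c = G \<omega> / ?R" for \<omega>
    unfolding G_def by (rule sample_mean_eq_scaled_sum[OF n1 \<Delta>(1)])
  have "1 - \<delta> \<le> measure Q (space Q - {\<omega> \<in> space Q. \<bar>G \<omega>\<bar> > exp 1 * \<Phi>})"
    using tail by (subst Q.prob_compl) auto
  also have "\<dots> \<le> measure Q {\<omega> \<in> space Q. \<bar>G \<omega> / ?R\<bar> \<le> \<epsilon>}"
    using threshold R by (intro Q.finite_measure_mono) (auto simp: field_simps abs_mult)
  finally show ?thesis
    by (simp only: mean)
qed

section \<open>Markov families and sums along a sampled path\<close>

text \<open>The Markov property is assumed only for the conditional law of a single later state,
  and it holds for the family as a whole: the same \<open>P\<close> describes the restart.\<close>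
locale markov_family =
  fixes M :: "'w measure" and F :: "real \<Rightarrow> 'w measure"
    and P :: "'a::topological_space \<Rightarrow> 'w measure" and X :: "real \<Rightarrow> 'w \<Rightarrow> 'a"
  assumes space_F: "space (F t) = space M"
    and sets_F_mono: "s \<le> t \<Longrightarrow> sets (F s) \<subseteq> sets (F t)"
    and sets_F: "sets (F t) \<subseteq> sets M"
    and kernel: "P \<in> borel \<rightarrow>\<^sub>M prob_algebra M"
    and adapted: "0 \<le> t \<Longrightarrow> X t \<in> F t \<rightarrow>\<^sub>M borel"
    and start: "AE \<omega> in P x. X 0 \<omega> = x"
    and markov: "0 \<le> s \<Longrightarrow> 0 \<le> t \<Longrightarrow> A \<in> sets borel \<Longrightarrow>
      AE \<omega> in P x. real_cond_exp (P x) (F t) (indicator (X (t + s) -` A \<inter> space M)) \<omega>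
        = measure (P (X t \<omega>)) (X s -` A \<inter> space M)"
begin

lemma prob_space_P: "prob_space (P x)"
  and sets_P [measurable_cong]: "sets (P x) = sets M"
  using measurable_space[OF kernel, of x] by (auto simp: space_prob_algebra)

lemma space_P: "space (P x) = space M"
  by (rule sets_eq_imp_space_eq[OF sets_P])

lemma P_measurable [measurable]: "P \<in> borel \<rightarrow>\<^sub>M subprob_algebra M"
  by (rule measurable_prob_algebraD[OF kernel])

lemma measurable_F_imp: "S \<in> F t \<rightarrow>\<^sub>M N \<Longrightarrow> S \<in> M \<rightarrow>\<^sub>M N"
  using sets_F[of t] space_F[of t] by (auto simp: measurable_def)

lemma measurable_F_mono: "s \<le> t \<Longrightarrow> S \<in> F s \<rightarrow>\<^sub>M N \<Longrightarrow> S \<in> F t \<rightarrow>\<^sub>M N"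
  using sets_F_mono[of s t] by (auto simp: measurable_def space_F)

lemma X_measurable [measurable]: "0 \<le> t \<Longrightarrow> X t \<in> M \<rightarrow>\<^sub>M borel"
  by (rule measurable_F_imp[OF adapted])

definition transition :: "real \<Rightarrow> 'a \<Rightarrow> 'a measure" where
  "transition s x = distr (P x) borel (X s)"

lemma transition_measurable [measurable]:
  assumes "0 \<le> s"
  shows "transition s \<in> borel \<rightarrow>\<^sub>M subprob_algebra borel"
proof -
  note [measurable] = X_measurable[OF assms]
  show ?thesis
    unfolding transition_def[abs_def]
    by (rule measurable_compose[OF P_measurable measurable_distr]) simp
qed

lemma sets_transition [simp, measurable_cong]: "sets (transition s x) = sets borel"
  by (simp add: transition_def)

text \<open>Integrating the conditional probability over an event \<open>B\<close> of the past removes the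
  conditional expectation, after which only measures and kernels occur.\<close>
lemma emeasure_rectangle:
  assumes s: "0 \<le> s" and t: "0 \<le> t" and B: "B \<in> sets (F t)" and A: "A \<in> sets borel"
  shows "emeasure (P x) (B \<inter> (X (t + s) -` A \<inter> space M))
    = (\<integral>\<^sup>+\<omega>. indicator B \<omega> * emeasure (transition s (X t \<omega>)) A \<partial>P x)"
proof -
  interpret prob_space "P x" by (rule prob_space_P)
  interpret sub: finite_measure_subalgebra "P x" "F t"
    by unfold_locales (use sets_F[of t] in \<open>auto simp: subalgebra_def space_F space_P sets_P\<close>)
  have ts: "0 \<le> t + s" using s t by simp
  note [measurable] = X_measurable[OF s] X_measurable[OF t] X_measurable[OF ts] A
  have [measurable]: "B \<in> sets M" using B sets_F by auto
  let ?E = "X (t + s) -` A \<inter> space M"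
  have E [measurable]: "?E \<in> sets (P x)"
    by (simp add: sets_P)
  have Kmeas: "(\<lambda>\<omega>. measure (P (X t \<omega>)) (X s -` A \<inter> space M)) \<in> borel_measurable (P x)"
    by measurable
  have "(\<integral>\<omega>. indicator B \<omega> * indicator ?E \<omega> \<partial>P x)
      = (\<integral>\<omega>. indicator B \<omega> * real_cond_exp (P x) (F t) (indicator ?E) \<omega> \<partial>P x)"
    by (rule sub.real_cond_exp_intg(2)[symmetric])
       (use B in \<open>auto intro!: integrable_const_bound[where B=1] simp: indicator_def\<close>)
  also have "\<dots> = (\<integral>\<omega>. indicator B \<omega> * measure (P (X t \<omega>)) (X s -` A \<inter> space M) \<partial>P x)"
    using Kmeas by (intro integral_cong_AE) (use markov[OF s t A, of x] in auto)
  finally have eq: "measure (P x) (B \<inter> ?E)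
      = (\<integral>\<omega>. indicator B \<omega> * measure (P (X t \<omega>)) (X s -` A \<inter> space M) \<partial>P x)"
    by (simp add: indicator_inter_arith[symmetric] Int_absorb2 Int_assoc space_P)
  have "emeasure (P x) (B \<inter> ?E)
      = (\<integral>\<^sup>+\<omega>. ennreal (indicator B \<omega> * measure (P (X t \<omega>)) (X s -` A \<inter> space M)) \<partial>P x)"
    unfolding emeasure_eq_measure eq
    using Kmeas
    by (intro nn_integral_eq_integral[symmetric] integrable_const_bound[where B=1])
       (auto simp: indicator_def intro!: prob_space.prob_le_1[OF prob_space_P])
  also have "\<dots> = (\<integral>\<^sup>+\<omega>. indicator B \<omega> * emeasure (transition s (X t \<omega>)) A \<partial>P x)"
  proof (intro nn_integral_cong)
    fix \<omega>
    interpret Y: prob_space "P (X t \<omega>)" by (rule prob_space_P)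
    show "ennreal (indicator B \<omega> * measure (P (X t \<omega>)) (X s -` A \<inter> space M))
      = indicator B \<omega> * emeasure (transition s (X t \<omega>)) A"
      by (simp add: transition_def emeasure_distr Y.emeasure_eq_measure space_P indicator_def)
  qed
  finally show ?thesis .
qed

text \<open>The rectangles \<open>B \<times> A\<close> are stable under intersection and generate the product \<open>\<sigma>\<close>-algebra,
  so the identity for rectangles determines the joint law of any \<open>F t\<close>-measurable quantity \<open>S\<close>
  and a later state. The quantity \<open>S\<close> carries the information about the past that the induction
  over the samples has to remember.\<close>
lemma joint_law:
  assumes s: "0 \<le> s" and t: "0 \<le> t" and S: "S \<in> F t \<rightarrow>\<^sub>M N"
  shows "distr (P x) (N \<Otimes>\<^sub>M borel) (\<lambda>\<omega>. (S \<omega>, X (t + s) \<omega>))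
    = P x \<bind> (\<lambda>\<omega>. distr (transition s (X t \<omega>)) (N \<Otimes>\<^sub>M borel) (Pair (S \<omega>)))" (is "?L = ?R")
proof -
  interpret prob_space "P x" by (rule prob_space_P)
  have ts: "0 \<le> t + s" using s t by simp
  note [measurable] = X_measurable[OF s] X_measurable[OF t] X_measurable[OF ts] measurable_F_imp[OF S]
    transition_measurable[OF s] measurable_distr2
  have k [measurable]: "(\<lambda>\<omega>. distr (transition s (X t \<omega>)) (N \<Otimes>\<^sub>M borel) (Pair (S \<omega>)))
      \<in> P x \<rightarrow>\<^sub>M subprob_algebra (N \<Otimes>\<^sub>M borel)"
    by (rule measurable_distr2[where M=borel]) measurable
  have sets_R: "sets ?R = sets (N \<Otimes>\<^sub>M borel)"
    by (rule sets_bind_measurable[OF k not_empty])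
  let ?E = "{a \<times> b |a b. a \<in> sets N \<and> b \<in> sets (borel :: 'a measure)}"
  show ?thesis
  proof (rule measure_eqI_generator_eq[OF Int_stable_pair_measure_generator[of N borel], where
      A = "\<lambda>_. space N \<times> UNIV"])
    show "?E \<subseteq> Pow (space N \<times> UNIV)"
      using sets.space_closed[of N] by auto
    show "sets ?L = sigma_sets (space N \<times> UNIV) ?E" "sets ?R = sigma_sets (space N \<times> UNIV) ?E"
      by (simp_all add: sets_R sets_pair_measure)
    show "range (\<lambda>_. space N \<times> UNIV) \<subseteq> ?E"
      by (intro image_subsetI CollectI exI[of _ "space N"] exI[of _ UNIV]) simp
    show "(\<Union>i::nat. space N \<times> UNIV) = space N \<times> UNIV"
      by simp
    show "emeasure ?L (space N \<times> UNIV) \<noteq> \<infinity>" for i :: nat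
      by (simp add: emeasure_distr emeasure_eq_measure)
    fix C assume "C \<in> ?E"
    then obtain B A where C: "C = B \<times> A" and [measurable]: "B \<in> sets N" "A \<in> sets borel"
      by auto
    have "emeasure ?L C = emeasure (P x) ((S -` B \<inter> space (F t)) \<inter> (X (t + s) -` A \<inter> space M))"
      unfolding C by (subst emeasure_distr) (auto simp: space_P space_F intro!: arg_cong[where f="emeasure (P x)"])
    also have "\<dots> = (\<integral>\<^sup>+\<omega>. indicator (S -` B \<inter> space (F t)) \<omega> * emeasure (transition s (X t \<omega>)) A \<partial>P x)"
      by (rule emeasure_rectangle[OF s t measurable_sets[OF S]]) auto
    also have "\<dots> = (\<integral>\<^sup>+\<omega>. emeasure (distr (transition s (X t \<omega>)) (N \<Otimes>\<^sub>M borel) (Pair (S \<omega>))) C \<partial>P x)"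
    proof (intro nn_integral_cong)
      fix \<omega> assume "\<omega> \<in> space (P x)"
      then have \<omega>: "\<omega> \<in> space M" by (simp add: space_P)
      then have "S \<omega> \<in> space N"
        using measurable_space[OF measurable_F_imp[OF S]] by auto
      then have [measurable]: "Pair (S \<omega>) \<in> transition s (X t \<omega>) \<rightarrow>\<^sub>M N \<Otimes>\<^sub>M borel"
        by measurable
      have "Pair (S \<omega>) -` C \<inter> space (transition s (X t \<omega>)) = (if S \<omega> \<in> B then A else {})"
        by (auto simp: C transition_def)
      then show "indicator (S -` B \<inter> space (F t)) \<omega> * emeasure (transition s (X t \<omega>)) A
          = emeasure (distr (transition s (X t \<omega>)) (N \<Otimes>\<^sub>M borel) (Pair (S \<omega>))) C"
        using \<omega> unfolding C by (subst emeasure_distr) (auto simp: space_F)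
    qed
    also have "\<dots> = emeasure ?R C"
      unfolding C by (rule emeasure_bind[OF not_empty k, symmetric]) simp
    finally show "emeasure ?L C = emeasure ?R C" .
  qed
qed

lemma nn_integral_step:
  assumes s: "0 \<le> s" and t: "0 \<le> t" and S: "S \<in> F t \<rightarrow>\<^sub>M N"
    and G [measurable]: "G \<in> borel_measurable (N \<Otimes>\<^sub>M borel)"
  shows "(\<integral>\<^sup>+\<omega>. G (S \<omega>, X (t + s) \<omega>) \<partial>P x)
    = (\<integral>\<^sup>+\<omega>. (\<integral>\<^sup>+z. G (S \<omega>, z) \<partial>transition s (X t \<omega>)) \<partial>P x)"
proof -
  have ts: "0 \<le> t + s" using s t by simp
  note [measurable] = X_measurable[OF s] X_measurable[OF t] X_measurable[OF ts] measurable_F_imp[OF S]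
    transition_measurable[OF s]
  have k [measurable]: "(\<lambda>\<omega>. distr (transition s (X t \<omega>)) (N \<Otimes>\<^sub>M borel) (Pair (S \<omega>)))
      \<in> P x \<rightarrow>\<^sub>M subprob_algebra (N \<Otimes>\<^sub>M borel)"
    by (rule measurable_distr2[where M=borel]) measurable
  have "(\<integral>\<^sup>+\<omega>. G (S \<omega>, X (t + s) \<omega>) \<partial>P x)
      = (\<integral>\<^sup>+y. G y \<partial>distr (P x) (N \<Otimes>\<^sub>M borel) (\<lambda>\<omega>. (S \<omega>, X (t + s) \<omega>)))"
    by (rule nn_integral_distr[symmetric]) measurable
  also have "\<dots> = (\<integral>\<^sup>+\<omega>. (\<integral>\<^sup>+y. G y \<partial>distr (transition s (X t \<omega>)) (N \<Otimes>\<^sub>M borel) (Pair (S \<omega>))) \<partial>P x)"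
    unfolding joint_law[OF s t S] by (rule nn_integral_bind[OF G k])
  also have "\<dots> = (\<integral>\<^sup>+\<omega>. (\<integral>\<^sup>+z. G (S \<omega>, z) \<partial>transition s (X t \<omega>)) \<partial>P x)"
  proof (intro nn_integral_cong)
    fix \<omega> assume "\<omega> \<in> space (P x)"
    then have [measurable]: "S \<omega> \<in> space N"
      using measurable_space[OF measurable_F_imp[OF S]] by (auto simp: space_P)
    show "(\<integral>\<^sup>+y. G y \<partial>distr (transition s (X t \<omega>)) (N \<Otimes>\<^sub>M borel) (Pair (S \<omega>)))
        = (\<integral>\<^sup>+z. G (S \<omega>, z) \<partial>transition s (X t \<omega>))"
      by (rule nn_integral_distr) measurable
  qed
  finally show ?thesis .
qed

text \<open>The function \<open>H\<close> depends on neither the starting point nor the time; it is the same for all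
  \<open>F t\<close>-measurable \<open>S\<close>. This uniformity drives the induction: the first of \<open>n + 1\<close> samples is
  added to \<open>S\<close>, the induction hypothesis applies at time \<open>t + \<Delta>\<close> to the enlarged \<open>S\<close>, and
  one application of the Markov property returns to time \<open>t\<close>.\<close>
lemma nn_integral_sampled_sum:
  fixes f :: "'a \<Rightarrow> real" and \<phi> :: "real \<Rightarrow> ennreal"
  assumes \<Delta>: "0 \<le> \<Delta>" and f [measurable]: "f \<in> borel_measurable borel"
    and \<phi> [measurable]: "\<phi> \<in> borel_measurable borel"
  shows "\<exists>H \<in> borel_measurable (borel \<Otimes>\<^sub>M borel). \<forall>x t S. 0 \<le> t \<longrightarrow> S \<in> borel_measurable (F t) \<longrightarrow>
    (\<integral>\<^sup>+\<omega>. \<phi> (S \<omega> + (\<Sum>k=1..n. f (X (t + real k * \<Delta>) \<omega>))) \<partial>P x) = (\<integral>\<^sup>+\<omega>. H (S \<omega>, X t \<omega>) \<partial>P x)"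
proof (induction n)
  case 0
  have "(\<lambda>y. \<phi> (fst y)) \<in> borel_measurable (borel \<Otimes>\<^sub>M borel)"
    by measurable
  then show ?case
    by (rule bexI[rotated]) simp
next
  case (Suc n)
  then obtain H where H [measurable]: "H \<in> borel_measurable (borel \<Otimes>\<^sub>M borel)"
    and IH: "\<And>x t S. 0 \<le> t \<Longrightarrow> S \<in> borel_measurable (F t) \<Longrightarrow>
      (\<integral>\<^sup>+\<omega>. \<phi> (S \<omega> + (\<Sum>k=1..n. f (X (t + real k * \<Delta>) \<omega>))) \<partial>P x) = (\<integral>\<^sup>+\<omega>. H (S \<omega>, X t \<omega>) \<partial>P x)"
    by blast
  note [measurable] = transition_measurable[OF \<Delta>]
  \<comment> \<open>One backward step of the recursion: move from \<open>y\<close> to \<open>z\<close> and add \<open>f z\<close> to the partial sum.\<close>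
  define H' where "H' = (\<lambda>(s, y). \<integral>\<^sup>+z. H (s + f z, z) \<partial>transition \<Delta> y)"
  have H': "H' \<in> borel_measurable (borel \<Otimes>\<^sub>M borel)"
    unfolding H'_def case_prod_unfold
    by (rule nn_integral_measurable_subprob_algebra2[where N=borel]) measurable
  have step_meas: "(\<lambda>(s, z). H (s + f z, z)) \<in> borel_measurable (borel \<Otimes>\<^sub>M borel)"
    by measurable
  have "(\<integral>\<^sup>+\<omega>. \<phi> (S \<omega> + (\<Sum>k=1..Suc n. f (X (t + real k * \<Delta>) \<omega>))) \<partial>P x) = (\<integral>\<^sup>+\<omega>. H' (S \<omega>, X t \<omega>) \<partial>P x)"
    if t: "0 \<le> t" and S: "S \<in> borel_measurable (F t)" for x t S
  proof -
    have t\<Delta>: "0 \<le> t + \<Delta>" using t \<Delta> by simp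
    have SF: "S \<in> borel_measurable (F (t + \<Delta>))"
      using \<Delta> by (intro measurable_F_mono[OF _ S]) simp
    have S': "(\<lambda>\<omega>. S \<omega> + f (X (t + \<Delta>) \<omega>)) \<in> borel_measurable (F (t + \<Delta>))"
      using SF measurable_compose[OF adapted[OF t\<Delta>] f] by (rule borel_measurable_add)
    have first_step: "(\<Sum>k=1..Suc n. f (X (t + real k * \<Delta>) \<omega>))
        = f (X (t + \<Delta>) \<omega>) + (\<Sum>k=1..n. f (X ((t + \<Delta>) + real k * \<Delta>) \<omega>))" for \<omega>
      by (simp only: One_nat_def sum.atLeast_Suc_atMost_Suc_shift o_def, subst sum.atLeast_Suc_atMost)
        (simp_all add: distrib_right add.assoc)
    have "(\<integral>\<^sup>+\<omega>. \<phi> (S \<omega> + (\<Sum>k=1..Suc n. f (X (t + real k * \<Delta>) \<omega>))) \<partial>P x)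
        = (\<integral>\<^sup>+\<omega>. \<phi> ((S \<omega> + f (X (t + \<Delta>) \<omega>)) + (\<Sum>k=1..n. f (X ((t + \<Delta>) + real k * \<Delta>) \<omega>))) \<partial>P x)"
      by (simp only: first_step add.assoc)
    also have "\<dots> = (\<integral>\<^sup>+\<omega>. H (S \<omega> + f (X (t + \<Delta>) \<omega>), X (t + \<Delta>) \<omega>) \<partial>P x)"
      by (rule IH[OF t\<Delta> S'])
    also have "\<dots> = (\<integral>\<^sup>+\<omega>. H' (S \<omega>, X t \<omega>) \<partial>P x)"
      using nn_integral_step[OF \<Delta> t S step_meas, of x] by (simp only: H'_def prod.case)
    finally show ?thesis .
  qed
  then show ?case
    using H' by blast
qed

text \<open>Both sides are governed by the same function \<open>H\<close> of the present state: at time \<open>t\<close> it is evaluated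
  at \<open>X t\<close>, while for a path that starts in \<open>y\<close> it is evaluated at \<open>y\<close> itself.\<close>
lemma nn_integral_sampled_sum_shift:
  fixes f :: "'a \<Rightarrow> real" and \<phi> :: "real \<Rightarrow> ennreal"
  assumes \<Delta>: "0 \<le> \<Delta>" and t: "0 \<le> t" and f [measurable]: "f \<in> borel_measurable borel"
    and \<phi> [measurable]: "\<phi> \<in> borel_measurable borel"
  shows "(\<integral>\<^sup>+\<omega>. \<phi> (\<Sum>k=1..n. f (X (t + real k * \<Delta>) \<omega>)) \<partial>P x)
    = (\<integral>\<^sup>+y. (\<integral>\<^sup>+\<omega>. \<phi> (\<Sum>k=1..n. f (X (real k * \<Delta>) \<omega>)) \<partial>P y) \<partial>transition t x)"
proof -
  obtain H where H [measurable]: "H \<in> borel_measurable (borel \<Otimes>\<^sub>M borel)"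
    and eq: "\<And>x t S. 0 \<le> t \<Longrightarrow> S \<in> borel_measurable (F t) \<Longrightarrow>
      (\<integral>\<^sup>+\<omega>. \<phi> (S \<omega> + (\<Sum>k=1..n. f (X (t + real k * \<Delta>) \<omega>))) \<partial>P x) = (\<integral>\<^sup>+\<omega>. H (S \<omega>, X t \<omega>) \<partial>P x)"
    using nn_integral_sampled_sum[OF \<Delta> f \<phi>, of n] by blast
  have start_at: "(\<integral>\<^sup>+\<omega>. \<phi> (\<Sum>k=1..n. f (X (real k * \<Delta>) \<omega>)) \<partial>P y) = H (0, y)" for y
  proof -
    interpret prob_space "P y" by (rule prob_space_P)
    have "(\<integral>\<^sup>+\<omega>. \<phi> (\<Sum>k=1..n. f (X (real k * \<Delta>) \<omega>)) \<partial>P y) = (\<integral>\<^sup>+\<omega>. H (0, X 0 \<omega>) \<partial>P y)"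
      using eq[of 0 "\<lambda>_. 0" y] by simp
    also have "\<dots> = (\<integral>\<^sup>+\<omega>. H (0, y) \<partial>P y)"
      by (rule nn_integral_cong_AE) (use start[of y] in auto)
    finally show ?thesis by (simp add: emeasure_space_1)
  qed
  note [measurable] = X_measurable[OF t]
  have "(\<integral>\<^sup>+\<omega>. \<phi> (\<Sum>k=1..n. f (X (t + real k * \<Delta>) \<omega>)) \<partial>P x) = (\<integral>\<^sup>+\<omega>. H (0, X t \<omega>) \<partial>P x)"
    using eq[of t "\<lambda>_. 0" x] t by simp
  also have "\<dots> = (\<integral>\<^sup>+y. H (0, y) \<partial>transition t x)"
    unfolding transition_def by (rule nn_integral_distr[symmetric]) measurable
  finally show ?thesis by (simp only: start_at)
qed

lemma bind_P:
  assumes "prob_space \<nu>" "sets \<nu> = sets borel"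
  shows prob_space_bind_P: "prob_space (\<nu> \<bind> P)"
    and sets_bind_P: "sets (\<nu> \<bind> P) = sets M"
    and space_bind_P: "space (\<nu> \<bind> P) = space M"
    and measure_bind_P: "A \<in> sets M \<Longrightarrow> measure (\<nu> \<bind> P) A = (\<integral>x. measure (P x) A \<partial>\<nu>)"
proof -
  interpret prob_space \<nu> by fact
  have \<nu>: "\<nu> \<in> space (prob_algebra borel)"
    using assms by (simp add: space_prob_algebra)
  show "prob_space (\<nu> \<bind> P)"
    by (rule prob_space_bind'[OF \<nu> kernel])
  show sets: "sets (\<nu> \<bind> P) = sets M"
    by (rule sets_bind'[OF \<nu> kernel])
  then show "space (\<nu> \<bind> P) = space M"
    by (rule sets_eq_imp_space_eq)
  have "P \<in> \<nu> \<rightarrow>\<^sub>M subprob_algebra M"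
    using P_measurable assms(2) by (simp cong: measurable_cong_sets)
  then show "A \<in> sets M \<Longrightarrow> measure (\<nu> \<bind> P) A = (\<integral>x. measure (P x) A \<partial>\<nu>)"
    by (rule measure_bind)
qed

lemma measure_P_measurable:
  "A \<in> sets M \<Longrightarrow> (\<lambda>x. measure (P x) A) \<in> borel_measurable borel"
  by (rule measurable_compose[OF P_measurable measurable_measure_subprob_algebra])

lemma prob_space_transition: "0 \<le> t \<Longrightarrow> prob_space (transition t x)"
  unfolding transition_def
  by (intro prob_space.prob_space_distr prob_space_P) simp

lemma sampled_sum_measurable [measurable]:
  fixes f :: "'a \<Rightarrow> real"
  assumes \<Delta>: "0 \<le> \<Delta>" and t: "0 \<le> t" and f: "f \<in> borel_measurable borel"
  shows "(\<lambda>\<omega>. \<Sum>k=1..n. f (X (t + real k * \<Delta>) \<omega>)) \<in> borel_measurable M"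
  using \<Delta> t by (intro borel_measurable_sum measurable_compose[OF X_measurable f]) simp

lemma sampled_sum_event:
  fixes f :: "'a \<Rightarrow> real"
  assumes "0 \<le> \<Delta>" and "0 \<le> t" and "f \<in> borel_measurable borel" and "B \<in> sets borel"
  shows "{\<omega> \<in> space M. (\<Sum>k=1..n. f (X (t + real k * \<Delta>) \<omega>)) \<in> B} \<in> sets M"
  using measurable_sets[OF sampled_sum_measurable[OF assms(1-3)] assms(4)]
  by (simp add: vimage_def Int_def conj_commute)

lemma measure_sampled_sum_shift:
  fixes f :: "'a \<Rightarrow> real"
  assumes \<Delta>: "0 \<le> \<Delta>" and t: "0 \<le> t" and f: "f \<in> borel_measurable borel" and B: "B \<in> sets borel"
  shows "measure (P x) {\<omega> \<in> space M. (\<Sum>k=1..n. f (X (t + real k * \<Delta>) \<omega>)) \<in> B}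
    = (\<integral>y. measure (P y) {\<omega> \<in> space M. (\<Sum>k=1..n. f (X (real k * \<Delta>) \<omega>)) \<in> B} \<partial>transition t x)"
proof -
  interpret Px: prob_space "P x" by (rule prob_space_P)
  interpret T: prob_space "transition t x" by (rule prob_space_transition[OF t])
  note [measurable] = B
  define E where "E s = {\<omega> \<in> space M. (\<Sum>k=1..n. f (X (s + real k * \<Delta>) \<omega>)) \<in> B}" for s
  have E: "E s \<in> sets M" if "0 \<le> s" for s
    unfolding E_def by (rule sampled_sum_event[OF \<Delta> that f B])
  have ind: "(\<integral>\<^sup>+\<omega>. indicator B (\<Sum>k=1..n. f (X (s + real k * \<Delta>) \<omega>)) \<partial>P y) = ennreal (measure (P y) (E s))"
    if s: "0 \<le> s" for s y
  proof -
    interpret Py: prob_space "P y" by (rule prob_space_P)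
    have "(\<integral>\<^sup>+\<omega>. indicator B (\<Sum>k=1..n. f (X (s + real k * \<Delta>) \<omega>)) \<partial>P y) = (\<integral>\<^sup>+\<omega>. indicator (E s) \<omega> \<partial>P y)"
      by (intro nn_integral_cong) (simp add: E_def indicator_def space_P)
    then show ?thesis
      using E[OF s] by (simp add: sets_P Py.emeasure_eq_measure)
  qed
  have E0: "(\<lambda>y. measure (P y) (E 0)) \<in> borel_measurable borel"
    by (rule measure_P_measurable[OF E]) simp
  have "ennreal (measure (P x) (E t)) = (\<integral>\<^sup>+y. ennreal (measure (P y) (E 0)) \<partial>transition t x)"
    using nn_integral_sampled_sum_shift[OF \<Delta> t f, where \<phi>="indicator B" and n=n and x=x] ind[OF t] ind[of 0] by simp
  also have "\<dots> = ennreal (\<integral>y. measure (P y) (E 0) \<partial>transition t x)"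
    using E0 by (intro nn_integral_eq_integral T.integrable_const_bound[where B=1])
      (auto intro!: prob_space.prob_le_1[OF prob_space_P])
  finally show ?thesis
    by (simp add: E_def integral_nonneg)
qed

end

lemma markovian_weak_solution_imp_markov_family:
  assumes "markovian_weak_solution M F P X b \<sigma>"
  shows "markov_family M F P X"
proof
  note d = assms[unfolded markovian_weak_solution_def]
  note fil = d[THEN conjunct1]
  note sets = d[THEN conjunct2, THEN conjunct1]
  note kernel = d[THEN conjunct2, THEN conjunct2, THEN conjunct1]
  note adapted = d[THEN conjunct2, THEN conjunct2, THEN conjunct2, THEN conjunct1]
  note weak = d[THEN conjunct2, THEN conjunct2, THEN conjunct2, THEN conjunct2, THEN conjunct2, THEN conjunct1]
  note markov = d[THEN conjunct2, THEN conjunct2, THEN conjunct2, THEN conjunct2, THEN conjunct2, THEN conjunct2]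
  show "space (F t) = space M" for t
    by (rule filtration.space_F[OF fil])
  show "sets (F s) \<subseteq> sets (F t)" if "s \<le> t" for s t
    by (rule filtration.sets_F_mono[OF fil that])
  show "sets (F t) \<subseteq> sets M" for t
    using sets by blast
  show "P \<in> borel \<rightarrow>\<^sub>M prob_algebra M"
    by (rule kernel)
  show "X t \<in> F t \<rightarrow>\<^sub>M borel" if "0 \<le> t" for t
    using adapted that by blast
  show "AE \<omega> in P x. X 0 \<omega> = x" for x
    using weak unfolding weak_solution_def by blast
  show "AE \<omega> in P x. real_cond_exp (P x) (F t) (indicator (X (t + s) -` A \<inter> space M)) \<omega>
      = measure (P (X t \<omega>)) (X s -` A \<inter> space M)"
    if "0 \<le> s" "0 \<le> t" "A \<in> sets borel" for x s t A
    using markov that by blast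
qed

section \<open>Total variation distance and burn-in\<close>

lemma tv_norm_diff_ge:
  fixes Q1 Q2 :: "(real^'d) measure"
  assumes "prob_space Q1" "prob_space Q2" and sets: "sets Q1 = sets borel" "sets Q2 = sets borel"
    and g: "g \<in> borel_measurable borel" "\<And>x. \<bar>g x\<bar> \<le> 1"
  shows "\<bar>(\<integral>x. g x \<partial>Q1) - (\<integral>x. g x \<partial>Q2)\<bar> \<le> tv_norm_diff Q1 Q2"
proof -
  have bounded: "\<bar>\<integral>x. h x \<partial>Q\<bar> \<le> 1"
    if Q: "prob_space Q" "sets Q = sets borel" and h: "h \<in> borel_measurable borel" "\<forall>x. \<bar>h x\<bar> \<le> 1"
    for Q and h :: "real^'d \<Rightarrow> real"
  proof -
    interpret prob_space Q by fact
    have [measurable]: "h \<in> borel_measurable Q"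
      using h(1) Q(2) by (simp cong: measurable_cong_sets)
    have "integrable Q h"
      using h by (intro integrable_const_bound[where B=1]) auto
    then have "-1 \<le> (\<integral>x. h x \<partial>Q)" "(\<integral>x. h x \<partial>Q) \<le> 1"
      using h(2) by (auto intro!: integral_ge_const integral_le_const simp: abs_le_iff minus_le_iff)
    then show ?thesis by simp
  qed
  show ?thesis
    unfolding tv_norm_diff_def
  proof (rule cSup_upper)
    show "bdd_above {\<bar>(\<integral>x. g x \<partial>Q1) - (\<integral>x. g x \<partial>Q2)\<bar> | g :: real^'d \<Rightarrow> real. g \<in> borel_measurable borel \<and> (\<forall>x. \<bar>g x\<bar> \<le> 1)}"
    proof (rule bdd_aboveI)
      fix y assume "y \<in> {\<bar>(\<integral>x. g x \<partial>Q1) - (\<integral>x. g x \<partial>Q2)\<bar> | g :: real^'d \<Rightarrow> real. g \<in> borel_measurable borel \<and> (\<forall>x. \<bar>g x\<bar> \<le> 1)}"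
      then obtain h where h: "h \<in> borel_measurable borel" "\<forall>x. \<bar>h x\<bar> \<le> 1"
        and y: "y = \<bar>(\<integral>x. h x \<partial>Q1) - (\<integral>x. h x \<partial>Q2)\<bar>"
        by blast
      show "y \<le> 2"
        unfolding y using bounded[OF assms(1) sets(1) h] bounded[OF assms(2) sets(2) h] by linarith
    qed
  qed (use g in auto)
qed

text \<open>The supremum in the total variation norm runs over functions with values in \<open>[-1, 1]\<close>. The
  function \<open>2 h - 1\<close> uses this whole range, which gains the factor \<open>1/2\<close> over testing with \<open>h\<close>.\<close>
lemma integral_diff_le_half_tv:
  fixes Q1 Q2 :: "(real^'d) measure"
  assumes "prob_space Q1" "prob_space Q2" and sets: "sets Q1 = sets borel" "sets Q2 = sets borel"
    and h [measurable]: "h \<in> borel_measurable borel" and h01: "\<And>x. 0 \<le> h x" "\<And>x. h x \<le> 1"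
  shows "(\<integral>x. h x \<partial>Q1) \<le> (\<integral>x. h x \<partial>Q2) + tv_norm_diff Q1 Q2 / 2"
proof -
  interpret Q1: prob_space Q1 by fact
  interpret Q2: prob_space Q2 by fact
  have [measurable]: "h \<in> borel_measurable Q1" "h \<in> borel_measurable Q2"
    using h sets by (simp_all cong: measurable_cong_sets)
  have "integrable Q1 h" "integrable Q2 h"
    using h01 by (auto intro!: Q1.integrable_const_bound[where B=1] Q2.integrable_const_bound[where B=1])
  then have "(\<integral>x. 2 * h x - 1 \<partial>Q1) - (\<integral>x. 2 * h x - 1 \<partial>Q2) = 2 * ((\<integral>x. h x \<partial>Q1) - (\<integral>x. h x \<partial>Q2))"
    by (simp add: Q1.prob_space Q2.prob_space)
  moreover have "\<bar>(\<integral>x. 2 * h x - 1 \<partial>Q1) - (\<integral>x. 2 * h x - 1 \<partial>Q2)\<bar> \<le> tv_norm_diff Q1 Q2"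
    using h01 by (intro tv_norm_diff_ge assms(1,2) sets) (auto simp: abs_le_iff minus_le_iff)
  ultimately have "\<bar>2 * ((\<integral>x. h x \<partial>Q1) - (\<integral>x. h x \<partial>Q2))\<bar> \<le> tv_norm_diff Q1 Q2"
    by (simp only:)
  then have "2 * ((\<integral>x. h x \<partial>Q1) - (\<integral>x. h x \<partial>Q2)) \<le> tv_norm_diff Q1 Q2"
    by (rule abs_le_D1)
  then show ?thesis by (simp add: field_simps)
qed

lemma tv_norm_diff_nonneg:
  fixes Q1 Q2 :: "(real^'d) measure"
  assumes "prob_space Q1" "prob_space Q2" "sets Q1 = sets borel" "sets Q2 = sets borel"
  shows "0 \<le> tv_norm_diff Q1 Q2"
  using tv_norm_diff_ge[OF assms, of "\<lambda>_. 0"] by simp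

text \<open>The probability of the event without burn-in, as a function of the starting point, takes values
  in \<open>[0, 1]\<close>. It is integrated once against the law of \<open>X t\<close>, by the Markov property, and once against
  \<open>\<mu>\<close>, and the two integrals are compared in total variation.\<close>
lemma burn_in_transfer:
  fixes P :: "real^'d \<Rightarrow> 'w measure" and f :: "real^'d \<Rightarrow> real"
  assumes "markov_family M F P X"
    and \<mu>: "prob_space \<mu>" "sets \<mu> = sets borel" and \<nu>: "prob_space \<nu>" "sets \<nu> = sets borel"
    and \<Delta>: "0 \<le> \<Delta>" and t: "0 \<le> t" and f: "f \<in> borel_measurable borel" and B: "B \<in> sets borel"
    and g: "integrable \<nu> g" and tv: "\<And>x. tv_norm_diff (distr (P x) borel (X t)) \<mu> / 2 \<le> g x"
  shows "measure (\<nu> \<bind> P) {\<omega> \<in> space M. (\<Sum>k=1..n. f (X (t + real k * \<Delta>) \<omega>)) \<in> B}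
    \<le> measure (\<mu> \<bind> P) {\<omega> \<in> space M. (\<Sum>k=1..n. f (X (real k * \<Delta>) \<omega>)) \<in> B} + (\<integral>x. g x \<partial>\<nu>)"
proof -
  interpret markov_family M F P X by fact
  interpret \<nu>: prob_space \<nu> by fact
  define E where "E s = {\<omega> \<in> space M. (\<Sum>k=1..n. f (X (s + real k * \<Delta>) \<omega>)) \<in> B}" for s
  have E: "E s \<in> sets M" if "0 \<le> s" for s
    unfolding E_def by (rule sampled_sum_event[OF \<Delta> that f B])
  have le: "measure (P x) (E t) \<le> measure (\<mu> \<bind> P) (E 0) + g x" for x
  proof -
    have "measure (P x) (E t) = (\<integral>y. measure (P y) (E 0) \<partial>transition t x)"
      unfolding E_def using measure_sampled_sum_shift[OF \<Delta> t f B] by simp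
    also have "\<dots> \<le> (\<integral>y. measure (P y) (E 0) \<partial>\<mu>) + tv_norm_diff (transition t x) \<mu> / 2"
      by (intro integral_diff_le_half_tv prob_space_transition t \<mu> measure_P_measurable E)
        (auto intro!: prob_space.prob_le_1[OF prob_space_P])
    also have "(\<integral>y. measure (P y) (E 0) \<partial>\<mu>) = measure (\<mu> \<bind> P) (E 0)"
      using measure_bind_P[OF \<mu> E[of 0]] by simp
    finally show ?thesis
      using tv[of x] by (simp add: transition_def)
  qed
  have [measurable]: "(\<lambda>x. measure (P x) (E t)) \<in> borel_measurable \<nu>"
    using measure_P_measurable[OF E[OF t]] \<nu>(2) by (simp cong: measurable_cong_sets)
  have "measure (\<nu> \<bind> P) (E t) = (\<integral>x. measure (P x) (E t) \<partial>\<nu>)"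
    by (rule measure_bind_P[OF \<nu> E[OF t]])
  also have "\<dots> \<le> (\<integral>x. measure (\<mu> \<bind> P) (E 0) + g x \<partial>\<nu>)"
  proof (rule integral_mono[OF _ _ le])
    show "integrable \<nu> (\<lambda>x. measure (P x) (E t))"
      by (rule \<nu>.integrable_const_bound[where B=1]) (auto intro!: prob_space.prob_le_1[OF prob_space_P])
  qed (use g in simp)
  also have "\<dots> = measure (\<mu> \<bind> P) (E 0) + (\<integral>x. g x \<partial>\<nu>)"
    using g by (simp add: \<nu>.prob_space)
  finally show ?thesis
    by (simp add: E_def)
qed

section \<open>Calibration of the burn-in length\<close>

text \<open>The burn-in length solves \<open>C exp (- (w m \<Delta>)\<^sup>\<kappa>) = \<delta>/2\<close> for \<open>m\<close>. If \<open>2 C \<le> \<delta>\<close>, the logarithm is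
  not positive and the bound on \<open>m\<close> says nothing useful, but then \<open>C\<close> alone is small enough.\<close>
lemma exp_burn_in_le:
  fixes \<kappa> C \<delta> \<Delta> m w :: real
  assumes "0 < \<kappa>" "0 < w" "0 < \<Delta>" "0 < \<delta>" "0 \<le> C"
    and m: "1 / \<Delta> * ln (2 * C / \<delta>) powr (1 / \<kappa>) / w \<le> m"
  shows "C * exp (- ((w * (m * \<Delta>)) powr \<kappa>)) \<le> \<delta> / 2"
proof (cases "2 * C \<le> \<delta>")
  case True
  have "C * exp (- ((w * (m * \<Delta>)) powr \<kappa>)) \<le> C * 1"
    using \<open>0 \<le> C\<close> by (intro mult_left_mono) auto
  then show ?thesis using True by simp
next
  case False
  then have C: "0 < C" and l: "0 < ln (2 * C / \<delta>)"
    using assms by auto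
  have "ln (2 * C / \<delta>) powr (1 / \<kappa>) \<le> w * (m * \<Delta>)"
    using m assms by (simp add: field_simps)
  then have "(ln (2 * C / \<delta>) powr (1 / \<kappa>)) powr \<kappa> \<le> (w * (m * \<Delta>)) powr \<kappa>"
    using assms by (intro powr_mono2) auto
  then have "ln (2 * C / \<delta>) \<le> (w * (m * \<Delta>)) powr \<kappa>"
    using assms l by (simp add: powr_powr)
  then have "exp (- ((w * (m * \<Delta>)) powr \<kappa>)) \<le> exp (- ln (2 * C / \<delta>))"
    by simp
  also have "\<dots> = \<delta> / (2 * C)"
    using assms C by (simp add: exp_minus)
  finally show ?thesis
    using C by (simp add: field_simps)
qed

text \<open>For \<open>t < 1\<close> the polynomial factor is at most \<open>2\<close>, since its exponent \<open>2 qp / (1 + qp)\<close> is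
  at most \<open>1\<close>, so half of it lies below \<open>c \<ge> 1\<close>. Without the factor \<open>1/2\<close> the inequality can fail there.\<close>
lemma half_rate_le:
  fixes qp w w' c t :: real
  assumes qp: "0 \<le> qp" "qp < 1" and w: "0 < w" "w < w'" and t: "0 \<le> t"
    and c: "\<And>t. t \<ge> 1 \<Longrightarrow> (1 + t) powr (2 * qp / (1 + qp)) * exp (- ((w' * t) powr ((1 - qp) / (1 + qp))))
          \<le> c * exp (- ((w * t) powr ((1 - qp) / (1 + qp))))"
    and case_t: "1 \<le> c \<or> 1 \<le> t"
  shows "(1 + t) powr (2 * qp / (1 + qp)) * exp (- ((w' * t) powr ((1 - qp) / (1 + qp)))) / 2
    \<le> c * exp (- ((w * t) powr ((1 - qp) / (1 + qp))))"
proof (cases "1 \<le> t")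
  case True
  let ?A = "(1 + t) powr (2 * qp / (1 + qp)) * exp (- ((w' * t) powr ((1 - qp) / (1 + qp))))"
  have "?A / 2 \<le> ?A" by simp
  then show ?thesis
    using c[OF True] by (rule order_trans)
next
  case False
  then have "1 \<le> c" using case_t by simp
  have "(1 + t) powr (2 * qp / (1 + qp)) \<le> 2 powr (2 * qp / (1 + qp))"
    using False t qp by (intro powr_mono2) auto
  also have "\<dots> \<le> 2 powr 1"
    using qp by (intro powr_mono) (auto simp: field_simps)
  finally have "(1 + t) powr (2 * qp / (1 + qp)) / 2 \<le> c"
    using \<open>1 \<le> c\<close> by simp
  moreover have "(w * t) powr ((1 - qp) / (1 + qp)) \<le> (w' * t) powr ((1 - qp) / (1 + qp))"
    using qp w t by (intro powr_mono2 mult_right_mono) auto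
  ultimately have "(1 + t) powr (2 * qp / (1 + qp)) / 2 * exp (- ((w' * t) powr ((1 - qp) / (1 + qp))))
      \<le> c * exp (- ((w * t) powr ((1 - qp) / (1 + qp))))"
    using \<open>1 \<le> c\<close> by (intro mult_mono) auto
  then show ?thesis by simp
qed


section \<open>Error bounds for the estimators\<close>

theorem corollary3p11:
  fixes M :: "'w measure" and F :: "real \<Rightarrow> 'w measure"
    and P :: "real^'d \<Rightarrow> 'w measure" and X :: "real \<Rightarrow> 'w \<Rightarrow> real^'d"
    and b :: "real^'d \<Rightarrow> real^'d" and \<sigma> :: "real^'d \<Rightarrow> real^'d^'d"
    and \<mu> :: "(real^'d) measure"
    and f :: "real^'d \<Rightarrow> real" and Df :: "real^'d \<Rightarrow> real^'d" and D2f :: "real^'d \<Rightarrow> real^'d^'d"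
    and q' q M0 rr qp lamp \<iota> \<iota>' \<iota>'' Cq c :: real
    and \<eta>1 \<eta>2 \<eta>3 L p0 \<alpha> \<gamma> \<rho> \<zeta> D \<epsilon> \<delta> \<Delta> :: real
    and n :: nat
  assumes "q' \<ge> 0" and "coefficient_assumptions b \<sigma> q'"
    and "- 1 \<le> q" and "q < 1" and "M0 \<ge> 0" and "rr > 0" and "drift_condition b q M0 rr"
    and "markovian_weak_solution M F P X b \<sigma>"
    and "invariant_distribution P X \<mu>"
    and "qp = max q 0" and "lamp = lambda_plus \<sigma>"
    and "\<iota> > 0" and "rr > \<iota> * lamp * (1 - qp) / 2"
    and "\<iota>' = \<iota> powr ((1 + qp) / (1 - qp)) * (1 + qp) * (rr - lamp * \<iota> * (1 - qp) / 2)"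
    and "0 < \<iota>''" and "\<iota>'' < \<iota>'"
    and TV: "\<And>x t. t \<ge> 0 \<Longrightarrow> tv_norm_diff (distr (P x) borel (X t)) \<mu>
          \<le> Cq * lyapunov \<iota> qp x * (1 + t) powr (2 * qp / (1 + qp))
              * exp (- ((\<iota>' * t) powr ((1 - qp) / (1 + qp))))"
    and c: "\<And>t. t \<ge> 1 \<Longrightarrow> (1 + t) powr (2 * qp / (1 + qp)) * exp (- ((\<iota>' * t) powr ((1 - qp) / (1 + qp))))
          \<le> c * exp (- ((\<iota>'' * t) powr ((1 - qp) / (1 + qp))))"
    and "\<eta>1 \<ge> 0" and "\<eta>2 \<ge> 0" and "\<eta>3 \<ge> 0" and "L > 0"
    and "p0 \<ge> real CARD('d)"
    and "f \<in> growth_class \<eta>1 L" and "f \<in> W2_loc p0"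
    and "\<And>i. weak_partial i f (\<lambda>x. Df x $ i)"
    and "\<And>i j. weak_partial j (\<lambda>x. Df x $ i) (\<lambda>x. D2f x $ i $ j)"
    and "(\<lambda>x. norm (Df x)) \<in> Lp_loc (2 * real CARD('d))"
    and "\<exists>K. AE x in lborel. norm (Df x) \<le> K * (1 + norm_pow x \<eta>2)"
    and "\<And>i j. \<exists>K. AE x in lborel. \<bar>D2f x $ i $ j\<bar> \<le> K * (1 + norm_pow x \<eta>3)"
    and "\<alpha> = max (q' + \<eta>2) \<eta>3"
    and "q > - 1 \<Longrightarrow> \<gamma> > 1 + q \<and> (\<exists>r>1. \<gamma> - (1 + q) > r * max \<alpha> ((1 + q) / (r - 1)))"
    and "q = - 1 \<Longrightarrow> \<gamma> = \<alpha>"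
    and "\<rho> = max ((\<gamma> + 2 * \<alpha> + 1 - qp) / 2) (\<eta>2 + 1 - qp) / (1 - qp)"
    and "\<zeta> = 1 / 2 + (\<eta>1 + q' + q + 1) / (1 - qp)"
    and D: "\<And>p n \<Delta>. 2 \<le> p \<Longrightarrow> 1 \<le> n \<Longrightarrow> 0 < \<Delta> \<Longrightarrow> \<Delta> \<le> 1 \<Longrightarrow>
          Lp_norm p (\<mu> \<bind> P) (scaled_sum X n \<Delta> (\<lambda>x. f x - (\<integral>y. f y \<partial>\<mu>)))
            \<le> ennreal (D * (sqrt (real n) * \<Delta> powr (3 / 2) + \<Delta> * p powr \<rho> + p powr \<zeta>))"
    and "\<epsilon> > 0" and "0 < \<delta>" and "\<delta> < exp (- 2)"
    and "0 < \<Delta>" and "\<Delta> \<le> 1" and "\<Delta> < \<epsilon> / (3 * exp 1 * D)"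
  shows "(real n \<ge> sample_size D \<rho> \<zeta> \<Delta> \<epsilon> \<delta> \<longrightarrow>
            measure (\<mu> \<bind> P) {\<omega> \<in> space (\<mu> \<bind> P).
              \<bar>1 / real n * (\<Sum>k=1..n. f (X (real k * \<Delta>) \<omega>)) - (\<integral>y. f y \<partial>\<mu>)\<bar> \<le> \<epsilon>} \<ge> 1 - \<delta>)
    \<and> (\<forall>\<nu> C m. prob_space \<nu> \<and> sets \<nu> = sets borel \<and> integrable \<nu> (lyapunov \<iota> qp) \<and>
            C = Cq * c * (\<integral>x. \<bar>lyapunov \<iota> qp x\<bar> \<partial>\<nu>) \<and>
            real n \<ge> sample_size D \<rho> \<zeta> \<Delta> \<epsilon> (\<delta> / 2) \<and>
            real m \<ge> max 1 (1 / \<Delta> * ln (2 * C / \<delta>) powr ((1 + qp) / (1 - qp)) / \<iota>'') \<and>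
            (1 \<le> c \<or> 1 \<le> real m * \<Delta>)
          \<longrightarrow> measure (\<nu> \<bind> P) {\<omega> \<in> space (\<nu> \<bind> P).
                \<bar>burn_in_mean X m n \<Delta> f \<omega> - (\<integral>y. f y \<partial>\<mu>)\<bar> \<le> \<epsilon>} \<ge> 1 - \<delta>)"
proof -
  interpret markov_family M F P X
    by (rule markovian_weak_solution_imp_markov_family) fact
  have \<mu>: "prob_space \<mu>" "sets \<mu> = sets borel"
    using \<open>invariant_distribution P X \<mu>\<close> by (auto simp: invariant_distribution_def)
  have f: "f \<in> borel_measurable borel"
    using \<open>f \<in> growth_class \<eta>1 L\<close> by (simp add: growth_class_def)
  have qp: "0 \<le> qp" "qp < 1"
    using \<open>qp = max q 0\<close> \<open>q < 1\<close> by auto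
  \<comment> \<open>The positive step size lies below \<open>\<epsilon> / (3 e D)\<close>, which would be zero or negative otherwise.\<close>
  have D_pos: "0 < D"
  proof (rule ccontr)
    assume "\<not> 0 < D"
    then have "\<epsilon> / (3 * exp 1 * D) \<le> 0"
      using \<open>\<epsilon> > 0\<close> by (auto simp: divide_nonneg_nonpos mult_nonneg_nonpos)
    then show False
      using \<open>\<Delta> < \<epsilon> / (3 * exp 1 * D)\<close> \<open>0 < \<Delta>\<close> by simp
  qed
  \<comment> \<open>The level \<open>d\<close> is free because the burn-in estimate needs \<open>\<delta> / 2\<close>; any smaller level keeps the
    exponent \<open>ln (1/d)\<close> above 2, where the moment bound applies.\<close>
  have stationary: "measure (\<mu> \<bind> P) {\<omega> \<in> space (\<mu> \<bind> P).
      \<bar>1 / real n * (\<Sum>k=1..n. f (X (real k * \<Delta>) \<omega>)) - (\<integral>y. f y \<partial>\<mu>)\<bar> \<le> \<epsilon>} \<ge> 1 - d"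
    if n: "sample_size D \<rho> \<zeta> \<Delta> \<epsilon> d \<le> real n" and d: "0 < d" "d \<le> \<delta>" for d
  proof (rule sample_mean_concentration[OF prob_space_bind_P[OF \<mu>] _ D_pos \<open>\<epsilon> > 0\<close> _ _ \<open>0 < \<Delta>\<close> _ _ n])
    show "(\<lambda>\<omega>. f (X t \<omega>)) \<in> borel_measurable (\<mu> \<bind> P)" if "0 \<le> t" for t
      using measurable_compose[OF X_measurable[OF that] f] sets_bind_P[OF \<mu>]
      by (simp cong: measurable_cong_sets)
    have "d < exp (- 2)"
      using d \<open>\<delta> < exp (- 2)\<close> by simp
    then have "ln d < ln (exp (- 2))"
      using d by (subst ln_less_cancel_iff) auto
    then have two: "2 \<le> ln (1 / d)"
      using d by (simp add: ln_div)
    show "d < 1"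
      using \<open>d < exp (- 2)\<close> by (rule less_trans) simp
    show "Lp_norm (ln (1 / d)) (\<mu> \<bind> P) (scaled_sum X n \<Delta> (\<lambda>x. f x - (\<integral>y. f y \<partial>\<mu>)))
        \<le> ennreal (D * (sqrt (real n) * \<Delta> powr (3 / 2) + \<Delta> * ln (1 / d) powr \<rho> + ln (1 / d) powr \<zeta>))"
      if "1 \<le> n"
      by (rule D[OF two that \<open>0 < \<Delta>\<close> \<open>\<Delta> \<le> 1\<close>])
  qed (use d \<open>\<Delta> < \<epsilon> / (3 * exp 1 * D)\<close> in auto)
  have burn_in: "measure (\<nu> \<bind> P) {\<omega> \<in> space (\<nu> \<bind> P). \<bar>burn_in_mean X m n \<Delta> f \<omega> - (\<integral>y. f y \<partial>\<mu>)\<bar> \<le> \<epsilon>} \<ge> 1 - \<delta>"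
    if \<nu>: "prob_space \<nu>" "sets \<nu> = sets borel" and V: "integrable \<nu> (lyapunov \<iota> qp)"
      and C: "C = Cq * c * (\<integral>x. \<bar>lyapunov \<iota> qp x\<bar> \<partial>\<nu>)"
      and n: "sample_size D \<rho> \<zeta> \<Delta> \<epsilon> (\<delta> / 2) \<le> real n"
      and m: "1 / \<Delta> * ln (2 * C / \<delta>) powr ((1 + qp) / (1 - qp)) / \<iota>'' \<le> real m"
      and c_or: "1 \<le> c \<or> 1 \<le> real m * \<Delta>"
    for \<nu> C m
  proof -
    define \<kappa> where "\<kappa> = (1 - qp) / (1 + qp)"
    define t where "t = real m * \<Delta>"
    define w where "w = c * exp (- ((\<iota>'' * t) powr \<kappa>))"
    define g where "g x = Cq * lyapunov \<iota> qp x * w" for x :: "real^'d"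
    have t: "0 \<le> t"
      unfolding t_def using \<open>0 < \<Delta>\<close> by simp
    \<comment> \<open>The signs of \<open>Cq\<close> and \<open>c\<close> follow from the inequalities they appear in: both bound
      nonnegative quantities by multiples of positive ones.\<close>
    have Cq: "0 \<le> Cq"
    proof -
      have "0 \<le> tv_norm_diff (transition 0 0) \<mu>"
        by (rule tv_norm_diff_nonneg[OF prob_space_transition \<mu>(1) sets_transition \<mu>(2)]) simp
      also have "\<dots> \<le> Cq * lyapunov \<iota> qp (0 :: real^'d)"
        using TV[of 0 0] by (simp add: transition_def)
      finally show ?thesis
        by (simp add: lyapunov_def zero_le_mult_iff)
    qed
    have "0 < c"
    proof -
      have "0 < (1 + 1) powr (2 * qp / (1 + qp)) * exp (- ((\<iota>' * 1) powr ((1 - qp) / (1 + qp))))"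
        by simp
      also have "\<dots> \<le> c * exp (- ((\<iota>'' * 1) powr ((1 - qp) / (1 + qp))))"
        by (rule c) simp
      finally show ?thesis
        by (simp add: zero_less_mult_iff)
    qed
    have tv: "tv_norm_diff (distr (P x) borel (X t)) \<mu> / 2 \<le> g x" for x
    proof -
      have "tv_norm_diff (distr (P x) borel (X t)) \<mu> / 2
          \<le> Cq * lyapunov \<iota> qp x * ((1 + t) powr (2 * qp / (1 + qp)) * exp (- ((\<iota>' * t) powr \<kappa>)) / 2)"
        using TV[OF t, of x] by (simp add: \<kappa>_def mult.assoc)
      also have "\<dots> \<le> g x"
        unfolding g_def w_def \<kappa>_def using c_or Cq
        by (intro mult_left_mono half_rate_le qp \<open>0 < \<iota>''\<close> \<open>\<iota>'' < \<iota>'\<close> t c)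
          (auto simp: t_def lyapunov_def)
      finally show ?thesis .
    qed
    have g: "integrable \<nu> g"
      unfolding g_def using V by simp
    have "(\<integral>x. \<bar>lyapunov \<iota> qp x\<bar> \<partial>\<nu>) = (\<integral>x. lyapunov \<iota> qp x \<partial>\<nu>)"
      by (simp add: lyapunov_def)
    then have "(\<integral>x. g x \<partial>\<nu>) = C * exp (- ((\<iota>'' * t) powr \<kappa>))"
      unfolding g_def C w_def by simp
    also have "\<dots> \<le> \<delta> / 2"
      unfolding t_def
    proof (rule exp_burn_in_le)
      show "0 \<le> C"
        unfolding C using Cq \<open>0 < c\<close> by simp
      show "1 / \<Delta> * ln (2 * C / \<delta>) powr (1 / \<kappa>) / \<iota>'' \<le> real m"
        using m by (simp add: \<kappa>_def)
    qed (use qp \<open>0 < \<iota>''\<close> \<open>0 < \<Delta>\<close> \<open>0 < \<delta>\<close> in \<open>auto simp: \<kappa>_def\<close>)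
    finally have remainder: "(\<integral>x. g x \<partial>\<nu>) \<le> \<delta> / 2" .
    \<comment> \<open>The bad event, expressed as a condition on the sum of the samples alone.\<close>
    define B where "B = {s. \<epsilon> < \<bar>1 / real n * s - (\<integral>y. f y \<partial>\<mu>)\<bar>}"
    have B: "B \<in> sets borel"
      unfolding B_def by measurable
    define E where "E s = {\<omega> \<in> space M. (\<Sum>k=1..n. f (X (s + real k * \<Delta>) \<omega>)) \<in> B}" for s
    have E: "E s \<in> sets M" if "0 \<le> s" for s
      unfolding E_def by (rule sampled_sum_event[OF less_imp_le[OF \<open>0 < \<Delta>\<close>] that f B])
    interpret Q\<mu>: prob_space "\<mu> \<bind> P" by (rule prob_space_bind_P[OF \<mu>])
    interpret Q\<nu>: prob_space "\<nu> \<bind> P" by (rule prob_space_bind_P[OF \<nu>])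
    have "measure (\<mu> \<bind> P) (space (\<mu> \<bind> P) - E 0) \<ge> 1 - \<delta> / 2"
    proof -
      have "space (\<mu> \<bind> P) - E 0 = {\<omega> \<in> space (\<mu> \<bind> P).
          \<bar>1 / real n * (\<Sum>k=1..n. f (X (real k * \<Delta>) \<omega>)) - (\<integral>y. f y \<partial>\<mu>)\<bar> \<le> \<epsilon>}"
        by (auto simp: E_def B_def space_bind_P[OF \<mu>])
      then show ?thesis
        using stationary[OF n] \<open>0 < \<delta>\<close> by simp
    qed
    then have "measure (\<mu> \<bind> P) (E 0) \<le> \<delta> / 2"
      using E[of 0] by (subst (asm) Q\<mu>.prob_compl) (auto simp: sets_bind_P[OF \<mu>])
    moreover have "measure (\<nu> \<bind> P) (E t) \<le> measure (\<mu> \<bind> P) (E 0) + (\<integral>x. g x \<partial>\<nu>)"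
      using burn_in_transfer[OF markov_family_axioms \<mu> \<nu> less_imp_le[OF \<open>0 < \<Delta>\<close>] t f B g tv, of n]
      by (simp add: E_def)
    ultimately have bad: "measure (\<nu> \<bind> P) (E t) \<le> \<delta>"
      using remainder by linarith
    have shift: "(\<Sum>k=m+1..n+m. f (X (real k * \<Delta>) \<omega>)) = (\<Sum>k=1..n. f (X (t + real k * \<Delta>) \<omega>))" for \<omega>
      using sum.shift_bounds_cl_nat_ivl[of "\<lambda>k. f (X (real k * \<Delta>) \<omega>)" 1 m n]
      by (simp add: t_def algebra_simps)
    have "{\<omega> \<in> space (\<nu> \<bind> P). \<bar>burn_in_mean X m n \<Delta> f \<omega> - (\<integral>y. f y \<partial>\<mu>)\<bar> \<le> \<epsilon>}
        = space (\<nu> \<bind> P) - E t"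
      unfolding burn_in_mean_def shift by (auto simp: E_def B_def space_bind_P[OF \<nu>])
    then show ?thesis
      using bad E[OF t] by (simp add: Q\<nu>.prob_compl sets_bind_P[OF \<nu>])
  qed
  show ?thesis
    using stationary[of \<delta>] \<open>0 < \<delta>\<close> by (auto intro!: burn_in)
qed

end
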